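(* Let $(\Gamma,\mathcal G)$ be a boundary pair associated with $\mathfrak h$. Then the following assertions are equivalent (where in each of (ii)–(v) the "for some" and the "for any" version may be used, all resulting assertions being equivalent): (i) The boundary pair is positive. (ii) The solution form $\mathfrak q_z(\phi):=\|S(z)\phi\|_{\mathcal H}^2$, $\phi\in\mathcal G^{1/2}$, is uniformly positive for some (any) $z\in\mathbb C\setminus\sigma(H^D)$. (iii) For some (any) $z\in\mathbb C\setminus\sigma(H^D)$ there is a constant $c(z)>0$ such that $\|S(z)\phi\|_{\mathcal H}\ge c(z)\|\phi\|_{\mathcal G}$ for all $\phi\in\mathcal G^{1/2}$. (iv) The form-valued function $z\mapsto-\mathfrak l_z$ is a uniformly strict Nevanlinna function, i.e. $-\operatorname{Im}\mathfrak l_z$ is uniformly positive for some (any) $z\in\mathbb C$ with $\operatorname{Im}z>0$. (v) The negative derivative $-\mathfrak l_\lambda'$ (with respect to $\lambda$) is a uniformly positive form for some (any) $\lambda\in\mathbb R\setminus\sigma(H^D)$.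
   Context: All Hilbert spaces are complex; inner products and sesquilinear forms are linear in the first argument. Let $\mathfrak h$ be a closed, non-negative, densely defined quadratic form in a Hilbert space $\mathcal H$ (the same symbol denotes its sesquilinear form), with domain $\mathcal H^1:=\operatorname{dom}\mathfrak h$, a Hilbert space with norm $\|u\|_{\mathcal H^1}^2=\mathfrak h(u)+\|u\|_{\mathcal H}^2$. A boundary pair associated with $\mathfrak h$ is a pair $(\Gamma,\mathcal G)$ of a Hilbert space $\mathcal G$ and a bounded operator $\Gamma\colon\mathcal H^1\to\mathcal G$ such that $\mathcal H^{1,D}:=\ker\Gamma$ is dense in $\mathcal H$ and $\mathcal G^{1/2}:=\operatorname{ran}\Gamma$ is dense in $\mathcal G$. The Dirichlet operator $H^D$ is the self-adjoint operator associated with the closed form $\mathfrak h|_{\mathcal H^{1,D}}$. For $z\in\mathbb C$ let $\mathcal N^1(z):=\{h\in\mathcal H^1: \mathfrak h(h,f)=z\langle h,f\rangle_{\mathcal H}\ \forall f\in\mathcal H^{1,D}\}$. For $z\notin\sigma(H^D)$, $\Gamma$ restricts to a bijection $\mathcal N^1(z)\to\mathcal G^{1/2}$, whose inverse is $S(z)\colon\mathcal G^{1/2}\to\mathcal N^1(z)\subset\mathcal H^1$. The Dirichlet-to-Neumann form is $\mathfrak l_z(\phi,\psi):=\mathfrak h(S(z)\phi,S(-1)\psi)-z\langle S(z)\phi,S(-1)\psi\rangle_{\mathcal H}$, $\phi,\psi\in\mathcal G^{1/2}$; it depends holomorphically on $z\in\mathbb C\setminus\sigma(H^D)$. $\operatorname{Im}\mathfrak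 l_z:=\frac1{2\mathrm i}(\mathfrak l_z-\mathfrak l_z^* )$ with $\mathfrak l_z^*(\phi,\psi)=\overline{\mathfrak l_z(\psi,\phi)}$. A form $\mathfrak a$ on $\mathcal G^{1/2}$ is uniformly positive if there is $c>0$ with $\mathfrak a(\phi,\phi)\ge c\|\phi\|_{\mathcal G}^2$ for all $\phi\in\mathcal G^{1/2}$. The boundary pair is positive if $\mathfrak q_{-1}(\phi)=\|S(-1)\phi\|_{\mathcal H}^2$ is uniformly positive. *)

theory Defs
  imports "HOL-Analysis.Analysis"
begin

text \<open>
  A complex inner product space is a complex structure on top of a \<^class>\<open>real_inner\<close> space whose
  real inner product is the real part of the complex one; norm and topology are therefore those of
  the library. The complex inner product is linear in its first argument.
\<close>

class complex_inner = real_inner +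
  fixes scaleC :: "complex \<Rightarrow> 'a \<Rightarrow> 'a" (infixr "*\<^sub>C" 75)
    and cinner :: "'a \<Rightarrow> 'a \<Rightarrow> complex"
  assumes scaleC_add_right: "c *\<^sub>C (x + y) = c *\<^sub>C x + c *\<^sub>C y"
    and scaleC_add_left: "(c + d) *\<^sub>C x = c *\<^sub>C x + d *\<^sub>C x"
    and scaleC_scaleC: "c *\<^sub>C d *\<^sub>C x = (c * d) *\<^sub>C x"
    and scaleR_eq_scaleC: "r *\<^sub>R x = complex_of_real r *\<^sub>C x"
    and cinner_commute: "cinner x y = cnj (cinner y x)"
    and cinner_add_left: "cinner (x + y) z = cinner x z + cinner y z"
    and cinner_scaleC_left: "cinner (c *\<^sub>C x) y = c * cinner x y"
    and inner_eq_Re_cinner: "inner x y = Re (cinner x y)"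

class chilbert_space = complex_inner + complete_space

lemma cinner_self: "cinner x x = complex_of_real ((norm x)\<^sup>2)"
  for x :: "'a::complex_inner"
proof (rule complex_eqI)
  show "Re (cinner x x) = Re (complex_of_real ((norm x)\<^sup>2))"
    by (simp add: power2_norm_eq_inner inner_eq_Re_cinner)
  have "Im (cinner x x) = - Im (cinner x x)"
    using arg_cong[OF cinner_commute[of x x], of Im] by simp
  then show "Im (cinner x x) = Im (complex_of_real ((norm x)\<^sup>2))"
    by simp
qed

instantiation complex :: chilbert_space
begin

definition scaleC_complex :: "complex \<Rightarrow> complex \<Rightarrow> complex"
  where "scaleC_complex c x = c * x"

definition cinner_complex :: "complex \<Rightarrow> complex \<Rightarrow> complex"
  where "cinner_complex x y = x * cnj y"

instance
  by standard
    (auto simp: scaleC_complex_def cinner_complex_def algebra_simps inner_complex_def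
      scaleR_conv_of_real)

end

definition csubspace :: "'a::complex_inner set \<Rightarrow> bool"
  where "csubspace V \<longleftrightarrow> 0 \<in> V \<and> (\<forall>u\<in>V. \<forall>v\<in>V. u + v \<in> V) \<and> (\<forall>c. \<forall>u\<in>V. c *\<^sub>C u \<in> V)"

definition clinear_on :: "'a::complex_inner set \<Rightarrow> ('a \<Rightarrow> 'b::complex_inner) \<Rightarrow> bool"
  where "clinear_on V f \<longleftrightarrow>
    (\<forall>u\<in>V. \<forall>v\<in>V. f (u + v) = f u + f v) \<and> (\<forall>c. \<forall>u\<in>V. f (c *\<^sub>C u) = c *\<^sub>C f u)"

definition sesquilinear_on :: "'a::complex_inner set \<Rightarrow> ('a \<Rightarrow> 'a \<Rightarrow> complex) \<Rightarrow> bool"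
  where "sesquilinear_on V a \<longleftrightarrow>
    (\<forall>u\<in>V. \<forall>v\<in>V. \<forall>w\<in>V. a (u + v) w = a u w + a v w \<and> a w (u + v) = a w u + a w v) \<and>
    (\<forall>c. \<forall>u\<in>V. \<forall>v\<in>V. a (c *\<^sub>C u) v = c * a u v \<and> a u (c *\<^sub>C v) = cnj c * a u v)"

text \<open>
  A form is represented by its sesquilinear form together with its domain; values outside the
  domain are irrelevant. Its quadratic form is the restriction to the diagonal.
\<close>

definition form_norm :: "('a::complex_inner \<Rightarrow> 'a \<Rightarrow> complex) \<Rightarrow> 'a \<Rightarrow> real"
  where "form_norm h u = sqrt (Re (h u u) + (norm u)\<^sup>2)"

text \<open>Closedness means that the domain is complete with respect to the form norm.\<close>

definition closed_nonneg_form :: "('h::chilbert_space \<Rightarrow> 'h \<Rightarrow> complex) \<Rightarrow> 'h set \<Rightarrow> bool"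
  where "closed_nonneg_form h H1 \<longleftrightarrow>
    csubspace H1 \<and> closure H1 = UNIV \<and> sesquilinear_on H1 h \<and>
    (\<forall>u\<in>H1. h u u \<in> \<real>\<^sub>\<ge>\<^sub>0) \<and>
    (\<forall>x :: nat \<Rightarrow> 'h. (\<forall>n. x n \<in> H1) \<and>
        (\<forall>e>0. \<exists>N. \<forall>m\<ge>N. \<forall>n\<ge>N. form_norm h (x m - x n) < e) \<longrightarrow>
      (\<exists>u\<in>H1. (\<lambda>n. form_norm h (x n - u)) \<longlonglongrightarrow> 0))"

definition ker_on :: "'h set \<Rightarrow> ('h \<Rightarrow> 'g::zero) \<Rightarrow> 'h set"
  where "ker_on H1 \<Gamma> = {u \<in> H1. \<Gamma> u = 0}"

definition boundary_pair ::
    "('h::chilbert_space \<Rightarrow> 'h \<Rightarrow> complex) \<Rightarrow> 'h set \<Rightarrow> ('h \<Rightarrow> 'g::chilbert_space) \<Rightarrow> bool"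
  where "boundary_pair h H1 \<Gamma> \<longleftrightarrow>
    clinear_on H1 \<Gamma> \<and> (\<exists>C. \<forall>u\<in>H1. norm (\<Gamma> u) \<le> C * form_norm h u) \<and>
    closure (ker_on H1 \<Gamma>) = UNIV \<and> closure (\<Gamma> ` H1) = UNIV"

text \<open>
  Unbounded operators are represented by their graphs. The operator associated with a form on
  \<open>V\<close> maps \<open>u\<close> to the vector \<open>w\<close> (unique if \<open>V\<close> is dense) that represents the form at \<open>u\<close>.
\<close>

definition form_operator ::
    "('h::complex_inner \<Rightarrow> 'h \<Rightarrow> complex) \<Rightarrow> 'h set \<Rightarrow> ('h \<times> 'h) set"
  where "form_operator a V = {(u, w). u \<in> V \<and> (\<forall>f\<in>V. a u f = cinner w f)}"

text \<open>
  \<open>z\<close> is in the resolvent set if \<open>A - z\<close> is a bijection from the domain of \<open>A\<close> onto the whole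
  space with bounded inverse \<open>R\<close>.
\<close>

definition resolvent_set :: "('h::complex_inner \<times> 'h) set \<Rightarrow> complex set"
  where "resolvent_set A = {z. \<exists>R. bounded_linear R \<and> clinear_on UNIV R \<and>
    (\<forall>w. (R w, w + z *\<^sub>C R w) \<in> A) \<and> (\<forall>(u, w)\<in>A. R (w - z *\<^sub>C u) = u)}"

definition spectrum :: "('h::complex_inner \<times> 'h) set \<Rightarrow> complex set"
  where "spectrum A = - resolvent_set A"

definition dirichlet_operator ::
    "('h::chilbert_space \<Rightarrow> 'h \<Rightarrow> complex) \<Rightarrow> 'h set \<Rightarrow> ('h \<Rightarrow> 'g::chilbert_space) \<Rightarrow> ('h \<times> 'h) set"
  where "dirichlet_operator h H1 \<Gamma> = form_operator h (ker_on H1 \<Gamma>)"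

definition weak_solutions ::
    "('h::chilbert_space \<Rightarrow> 'h \<Rightarrow> complex) \<Rightarrow> 'h set \<Rightarrow> ('h \<Rightarrow> 'g::chilbert_space) \<Rightarrow> complex \<Rightarrow> 'h set"
  where "weak_solutions h H1 \<Gamma> z = {u \<in> H1. \<forall>f\<in>ker_on H1 \<Gamma>. h u f = z * cinner u f}"

text \<open>
  Only meaningful for \<open>z\<close> outside the spectrum of the Dirichlet operator and on \<open>\<Gamma> ` H1\<close>: there
  \<open>\<Gamma>\<close> is a bijection from the weak solutions onto \<open>\<Gamma> ` H1\<close>.
\<close>

definition solution_operator ::
    "('h::chilbert_space \<Rightarrow> 'h \<Rightarrow> complex) \<Rightarrow> 'h set \<Rightarrow> ('h \<Rightarrow> 'g::chilbert_space) \<Rightarrow> complex \<Rightarrow> 'g \<Rightarrow> 'h"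
  where "solution_operator h H1 \<Gamma> z = inv_into (weak_solutions h H1 \<Gamma> z) \<Gamma>"

definition dn_form ::
    "('h::chilbert_space \<Rightarrow> 'h \<Rightarrow> complex) \<Rightarrow> 'h set \<Rightarrow> ('h \<Rightarrow> 'g::chilbert_space) \<Rightarrow>
      complex \<Rightarrow> 'g \<Rightarrow> 'g \<Rightarrow> complex"
  where "dn_form h H1 \<Gamma> z \<phi> \<psi> =
    (let S = solution_operator h H1 \<Gamma> in h (S z \<phi>) (S (-1) \<psi>) - z * cinner (S z \<phi>) (S (-1) \<psi>))"

text \<open>
  The derivative is taken pointwise in the arguments of the form; it is the complex derivative,
  also at real \<open>z\<close>.
\<close>

definition dn_form_deriv ::
    "('h::chilbert_space \<Rightarrow> 'h \<Rightarrow> complex) \<Rightarrow> 'h set \<Rightarrow> ('h \<Rightarrow> 'g::chilbert_space) \<Rightarrow>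
      complex \<Rightarrow> 'g \<Rightarrow> 'g \<Rightarrow> complex"
  where "dn_form_deriv h H1 \<Gamma> z \<phi> \<psi> = deriv (\<lambda>w. dn_form h H1 \<Gamma> w \<phi> \<psi>) z"

definition form_adjoint :: "('g \<Rightarrow> 'g \<Rightarrow> complex) \<Rightarrow> 'g \<Rightarrow> 'g \<Rightarrow> complex"
  where "form_adjoint a \<phi> \<psi> = cnj (a \<psi> \<phi>)"

definition form_Im :: "('g \<Rightarrow> 'g \<Rightarrow> complex) \<Rightarrow> 'g \<Rightarrow> 'g \<Rightarrow> complex"
  where "form_Im a \<phi> \<psi> = (a \<phi> \<psi> - form_adjoint a \<phi> \<psi>) / (2 * \<i>)"

text \<open>
  Formulated for the quadratic form \<open>q\<close>, so a sesquilinear form \<open>a\<close> is passed as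
  \<open>\<lambda>\<phi>. a \<phi> \<phi>\<close>. The inequality between complex numbers includes that \<open>q \<phi>\<close> is real.
\<close>

definition uniformly_positive_on :: "'g::complex_inner set \<Rightarrow> ('g \<Rightarrow> complex) \<Rightarrow> bool"
  where "uniformly_positive_on V q \<longleftrightarrow>
    (\<exists>c>0. \<forall>\<phi>\<in>V. q \<phi> - complex_of_real (c * (norm \<phi>)\<^sup>2) \<in> \<real>\<^sub>\<ge>\<^sub>0)"

definition solution_form ::
    "('h::chilbert_space \<Rightarrow> 'h \<Rightarrow> complex) \<Rightarrow> 'h set \<Rightarrow> ('h \<Rightarrow> 'g::chilbert_space) \<Rightarrow>
      complex \<Rightarrow> 'g \<Rightarrow> complex"
  where "solution_form h H1 \<Gamma> z \<phi> = complex_of_real ((norm (solution_operator h H1 \<Gamma> z \<phi>))\<^sup>2)"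

definition positive_boundary_pair ::
    "('h::chilbert_space \<Rightarrow> 'h \<Rightarrow> complex) \<Rightarrow> 'h set \<Rightarrow> ('h \<Rightarrow> 'g::chilbert_space) \<Rightarrow> bool"
  where "positive_boundary_pair h H1 \<Gamma> \<longleftrightarrow>
    uniformly_positive_on (\<Gamma> ` H1) (solution_form h H1 \<Gamma> (-1))"

end

theory Submission
  imports Defs
begin

text \<open>
  If \<open>R\<close> is the resolvent of the Dirichlet operator at \<open>z\<close>, then
  \<open>S z = S w + (z - w) R (S w)\<close>, so the norms of \<open>S z \<phi>\<close> and \<open>S w \<phi>\<close> are comparable
  uniformly in \<open>\<phi>\<close>, and a lower bound at one point of the resolvent set gives one at every other.
  In the second argument of the Dirichlet-to-Neumann form \<open>S (-1)\<close> may be replaced by any \<open>S w\<close>;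
  taking \<open>w = z\<close> gives \<open>- Im l\<^sub>z(\<phi>, \<phi>) = Im z \<parallel>S z \<phi>\<parallel>\<^sup>2\<close>, and differentiating at real \<open>\<lambda>\<close>
  gives \<open>- l'\<^sub>\<lambda>(\<phi>, \<phi>) = \<parallel>S \<lambda> \<phi>\<parallel>\<^sup>2\<close>. All conditions thus bound the same quantity from below.
\<close>

section \<open>Complex inner product spaces\<close>

lemma cinner_add_right: "cinner x (y + z) = cinner x y + cinner x z"
  for x :: "'a::complex_inner"
  by (subst (1 2 3) cinner_commute) (simp add: cinner_add_left)

lemma cinner_scaleC_right: "cinner x (c *\<^sub>C y) = cnj c * cinner x y"
  for x :: "'a::complex_inner"
  by (subst (1 2) cinner_commute) (simp add: cinner_scaleC_left)

lemma cinner_diff_left: "cinner (x - y) z = cinner x z - cinner y z"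
  for x :: "'a::complex_inner"
  using cinner_add_left[of "x - y" y z] by simp

lemma cinner_diff_right: "cinner x (y - z) = cinner x y - cinner x z"
  for x :: "'a::complex_inner"
  using cinner_add_right[of x "y - z" z] by simp

lemma scaleC_one [simp]: "1 *\<^sub>C x = x"
  for x :: "'a::complex_inner"
  using scaleR_eq_scaleC[of 1 x] by simp

lemma scaleC_zero_left [simp]: "0 *\<^sub>C x = 0"
  for x :: "'a::complex_inner"
  using scaleR_eq_scaleC[of 0 x] by simp

lemma scaleC_zero_right [simp]: "c *\<^sub>C 0 = (0::'a::complex_inner)"
  using scaleC_add_right[of c 0 "0::'a"] by simp

lemma scaleC_diff_left: "(c - d) *\<^sub>C x = c *\<^sub>C x - d *\<^sub>C x"
  for x :: "'a::complex_inner"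
  using scaleC_add_left[of "c - d" d x] by simp

lemma scaleC_diff_right: "c *\<^sub>C (x - y) = c *\<^sub>C x - c *\<^sub>C y"
  for x :: "'a::complex_inner"
  using scaleC_add_right[of c "x - y" y] by simp

lemma scaleC_minus_left: "(- c) *\<^sub>C x = - (c *\<^sub>C x)"
  for x :: "'a::complex_inner"
  using scaleC_diff_left[of 0 c x] by simp

lemma scaleC_scaleR: "c *\<^sub>C (r *\<^sub>R x) = r *\<^sub>R (c *\<^sub>C x)"
  for x :: "'a::complex_inner"
  by (simp add: scaleR_eq_scaleC scaleC_scaleC mult.commute)

lemma norm_scaleC [simp]: "norm (c *\<^sub>C x) = cmod c * norm x"
  for x :: "'a::complex_inner"
proof (rule power2_eq_imp_eq)
  have "complex_of_real ((norm (c *\<^sub>C x))\<^sup>2) = cinner (c *\<^sub>C x) (c *\<^sub>C x)"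
    by (rule cinner_self[symmetric])
  also have "\<dots> = (c * cnj c) * cinner x x"
    by (simp add: cinner_scaleC_left cinner_scaleC_right)
  also have "\<dots> = complex_of_real ((cmod c * norm x)\<^sup>2)"
    by (simp add: cinner_self complex_norm_square[symmetric] power_mult_distrib)
  finally show "(norm (c *\<^sub>C x))\<^sup>2 = (cmod c * norm x)\<^sup>2"
    using of_real_eq_iff by blast
qed auto

text \<open>Reduces to the real Cauchy-Schwarz inequality: a unimodular factor \<open>c\<close> on
  \<open>x\<close> rotates \<open>cinner x y\<close> onto the non-negative real axis, where it
  agrees with the real inner product.\<close>

lemma cmod_cinner_le: "cmod (cinner x y) \<le> norm x * norm y"
  for x :: "'a::complex_inner"
proof -
  obtain c where c: "cmod c = 1" "c * cinner x y = complex_of_real (cmod (cinner x y))"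
  proof (cases "cinner x y = 0")
    case True
    show ?thesis by (rule that[of 1]) (simp_all add: True)
  next
    case False
    show ?thesis
      by (rule that[of "cnj (cinner x y) / cmod (cinner x y)"])
        (use False in \<open>simp_all add: norm_divide complex_norm_square[symmetric]
          power2_eq_square mult.commute\<close>)
  qed
  have "cmod (cinner x y) = Re (cinner (c *\<^sub>C x) y)"
    by (simp add: cinner_scaleC_left c)
  also have "\<dots> = inner (c *\<^sub>C x) y"
    by (simp add: inner_eq_Re_cinner)
  also have "\<dots> \<le> norm (c *\<^sub>C x) * norm y"
    by (rule norm_cauchy_schwarz)
  finally show ?thesis by (simp add: c)
qed

lemma csubspace_scaleR: "csubspace V \<Longrightarrow> u \<in> V \<Longrightarrow> r *\<^sub>R u \<in> V"
  by (simp add: csubspace_def scaleR_eq_scaleC)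

lemma csubspace_diff: "csubspace V \<Longrightarrow> u \<in> V \<Longrightarrow> v \<in> V \<Longrightarrow> u - v \<in> V"
  using csubspace_scaleR[of V v "- 1"] unfolding csubspace_def
  by (metis add_uminus_conv_diff scaleR_minus1_left)

lemma clinear_on_diff:
  assumes "csubspace V" "clinear_on V f" "u \<in> V" "v \<in> V"
  shows "f (u - v) = f u - f v"
proof -
  have "f u = f ((u - v) + v)" by simp
  also have "\<dots> = f (u - v) + f v"
    using assms csubspace_diff[of V u v] unfolding clinear_on_def by blast
  finally show ?thesis by simp
qed

lemma clinear_on_UNIV_scaleC: "clinear_on UNIV f \<Longrightarrow> f (c *\<^sub>C x) = c *\<^sub>C f x"
  by (simp add: clinear_on_def)

lemma bounded_linear_scaleC: "bounded_linear (\<lambda>x. c *\<^sub>C x)"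
  by (rule bounded_linear_intro[of _ "cmod c"])
    (simp_all add: scaleC_add_right scaleC_scaleR mult.commute)

lemma bounded_clinearI:
  assumes "\<And>x y. f (x + y) = f x + f y" "\<And>c x. f (c *\<^sub>C x) = c *\<^sub>C f x"
    and "\<And>x. norm (f x) \<le> K * norm x"
  shows "bounded_linear f" "clinear_on UNIV f"
  using assms
  by (auto intro!: bounded_linear_intro[of _ K] simp: clinear_on_def scaleR_eq_scaleC mult.commute)

section \<open>The Lax--Milgram lemma\<close>

text \<open>For small \<open>t > 0\<close> the map \<open>u \<mapsto> u - t (T u - w)\<close> is a contraction, and its fixed point
  solves \<open>T u = w\<close>.\<close>

lemma coercive_ex1:
  fixes T :: "'a::{real_inner, complete_space} \<Rightarrow> 'a"
  assumes T: "bounded_linear T" and c: "c > 0"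
    and coercive: "\<And>u. inner (T u) u \<ge> c * (norm u)\<^sup>2"
  shows "\<exists>!u. T u = w"
proof -
  interpret bounded_linear T by (rule T)
  obtain M where M: "M > 0" "\<And>u. norm (T u) \<le> norm u * M"
    using pos_bounded by blast
  \<comment> \<open>This choice gives \<open>t * M^2 \<le> c\<close>, so the quadratic term costs at
    most half of the gain \<open>2 * t * c\<close>, and \<open>t * c \<le> 1\<close>, so the square
    root in \<open>k\<close> is taken of a non-negative number.\<close>
  define t where "t = c / (M\<^sup>2 + c\<^sup>2)"
  define k where "k = sqrt (1 - t * c)"
  have den: "M\<^sup>2 + c\<^sup>2 > 0" using c by (simp add: add_nonneg_pos)
  have t: "t > 0" using c den by (simp add: t_def)
  have tM: "t * M\<^sup>2 \<le> c"
  proof -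
    have "t * M\<^sup>2 \<le> t * (M\<^sup>2 + c\<^sup>2)" using t by (intro mult_left_mono) auto
    also have "\<dots> = c" using den by (simp add: t_def)
    finally show ?thesis .
  qed
  have tc: "t * c \<le> 1"
  proof -
    have "t * c = c\<^sup>2 / (M\<^sup>2 + c\<^sup>2)" by (simp add: t_def power2_eq_square)
    also have "\<dots> \<le> 1" using den by (simp add: divide_le_eq_1)
    finally show ?thesis .
  qed
  have k: "0 \<le> k" "k < 1" using tc t c by (simp_all add: k_def)
  have contr: "norm (u - t *\<^sub>R T u) \<le> k * norm u" for u
  proof (rule power2_le_imp_le)
    have "(norm (u - t *\<^sub>R T u))\<^sup>2 = (norm u)\<^sup>2 - 2 * t * inner (T u) u + t\<^sup>2 * (norm (T u))\<^sup>2"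
      unfolding power2_norm_eq_inner
      by (simp add: inner_diff_left inner_diff_right inner_commute[of u "T u"]
          power2_eq_square algebra_simps)
    also have "\<dots> \<le> (norm u)\<^sup>2 - 2 * t * (c * (norm u)\<^sup>2) + t\<^sup>2 * (norm u * M)\<^sup>2"
    proof -
      have "2 * t * inner (T u) u \<ge> 2 * t * (c * (norm u)\<^sup>2)"
        using coercive[of u] t by (intro mult_left_mono) auto
      moreover have "t\<^sup>2 * (norm (T u))\<^sup>2 \<le> t\<^sup>2 * (norm u * M)\<^sup>2"
        using M(2)[of u] by (intro mult_left_mono power_mono) auto
      ultimately show ?thesis by linarith
    qed
    also have "\<dots> = (1 - 2 * t * c + t * (t * M\<^sup>2)) * (norm u)\<^sup>2"
      by (simp add: power2_eq_square algebra_simps)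
    also have "\<dots> \<le> (1 - 2 * t * c + t * c) * (norm u)\<^sup>2"
      using tM t by (intro mult_right_mono add_left_mono mult_left_mono) auto
    also have "\<dots> = (k * norm u)\<^sup>2"
      using tc by (simp add: k_def power_mult_distrib)
    finally show "(norm (u - t *\<^sub>R T u))\<^sup>2 \<le> (k * norm u)\<^sup>2" .
  qed (use k in auto)
  have "\<exists>!u. u - t *\<^sub>R (T u - w) = u"
  proof (rule banach_fix_type[of k])
    show "\<forall>u v. dist (u - t *\<^sub>R (T u - w)) (v - t *\<^sub>R (T v - w)) \<le> k * dist u v"
    proof (intro allI)
      fix u v
      have "u - t *\<^sub>R (T u - w) - (v - t *\<^sub>R (T v - w)) = (u - v) - t *\<^sub>R T (u - v)"
        by (simp add: diff algebra_simps)
      then show "dist (u - t *\<^sub>R (T u - w)) (v - t *\<^sub>R (T v - w)) \<le> k * dist u v"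
        unfolding dist_norm using contr[of "u - v"] by metis
    qed
  qed (use k in auto)
  then show ?thesis using t by simp
qed

text \<open>The factor \<open>\<theta>\<close> allows coercivity in any complex direction:
  \<open>\<theta> T\<close> is coercive for the real inner product, so the real lemma applies to
  it.\<close>

lemma complex_coercive_inverse:
  fixes T :: "'a::chilbert_space \<Rightarrow> 'a"
  assumes T: "bounded_linear T" "clinear_on UNIV T" and c: "c > 0"
    and coercive: "\<And>u. Re (\<theta> * cinner (T u) u) \<ge> c * (norm u)\<^sup>2"
  obtains Q where "bounded_linear Q" "clinear_on UNIV Q" "\<And>w. T (Q w) = w" "\<And>u. Q (T u) = u"
proof -
  have ex1: "\<exists>!u. T u = w" for w
  proof -
    have bl: "bounded_linear (\<lambda>u. \<theta> *\<^sub>C T u)"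
      using bounded_linear_compose[OF bounded_linear_scaleC T(1)] .
    have co: "inner (\<theta> *\<^sub>C T u) u \<ge> c * (norm u)\<^sup>2" for u
      using coercive[of u] by (simp add: inner_eq_Re_cinner cinner_scaleC_left)
    have ex1: "\<exists>!u. \<theta> *\<^sub>C T u = \<theta> *\<^sub>C w"
      by (rule coercive_ex1[OF bl c co])
    show ?thesis
    proof (cases "\<theta> = 0")
      \<comment> \<open>With \<open>\<theta> = 0\<close> coercivity forces the space to be
        trivial.\<close>
      case True
      then have "c * (norm u)\<^sup>2 \<le> 0" for u :: 'a using coercive[of u] by simp
      then have "u = 0" for u :: 'a using c by (auto simp: mult_le_0_iff)
      then show ?thesis by metis
    next
      case False
      then have "\<theta> *\<^sub>C x = \<theta> *\<^sub>C y \<longleftrightarrow> x = y" for x y :: 'a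
        by (metis scaleC_scaleC scaleC_one left_inverse)
      then show ?thesis using ex1 by simp
    qed
  qed
  define Q where "Q w = (THE u. T u = w)" for w
  have TQ: "T (Q w) = w" for w
    unfolding Q_def by (rule theI'[OF ex1])
  have QT: "Q (T u) = u" for u
    using ex1[of "T u"] TQ[of "T u"] by blast
  have add: "Q (x + y) = Q x + Q y" for x y
    by (metis QT TQ linear_simps(1)[OF T(1)])
  have scale: "Q (r *\<^sub>C x) = r *\<^sub>C Q x" for r x
    by (metis QT TQ clinear_on_UNIV_scaleC[OF T(2)])
  \<comment> \<open>Coercivity at \<open>Q w\<close> and Cauchy-Schwarz, divided by
    \<open>norm (Q w)\<close>.\<close>
  have bound: "norm (Q w) \<le> (cmod \<theta> / c) * norm w" for w
  proof (cases "Q w = 0")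
    case False
    have "c * (norm (Q w))\<^sup>2 \<le> Re (\<theta> * cinner w (Q w))"
      using coercive[of "Q w"] by (simp add: TQ)
    also have "\<dots> \<le> cmod (\<theta> * cinner w (Q w))"
      by (rule complex_Re_le_cmod)
    also have "\<dots> \<le> cmod \<theta> * (norm w * norm (Q w))"
      unfolding norm_mult by (intro mult_left_mono cmod_cinner_le) auto
    finally have "(c * norm (Q w)) * norm (Q w) \<le> (cmod \<theta> * norm w) * norm (Q w)"
      by (simp add: power2_eq_square mult.assoc)
    then have "c * norm (Q w) \<le> cmod \<theta> * norm w"
      using False by (subst (asm) mult_le_cancel_right) simp
    then show ?thesis using c by (simp add: field_simps)
  qed (use c in simp)
  show thesis
    by (rule that[OF bounded_clinearI[OF add scale bound] TQ QT])
qed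

section \<open>Resolvents of linear relations\<close>

text \<open>The body of \<open>resolvent_set\<close> with its witness exposed, so that one resolvent
  can be used in several formulas.\<close>

definition is_resolvent :: "('h::complex_inner \<times> 'h) set \<Rightarrow> complex \<Rightarrow> ('h \<Rightarrow> 'h) \<Rightarrow> bool"
  where "is_resolvent A z R \<longleftrightarrow> bounded_linear R \<and> clinear_on UNIV R \<and>
    (\<forall>w. (R w, w + z *\<^sub>C R w) \<in> A) \<and> (\<forall>(u, w)\<in>A. R (w - z *\<^sub>C u) = u)"

lemma resolvent_set_iff: "z \<in> resolvent_set A \<longleftrightarrow> (\<exists>R. is_resolvent A z R)"
  by (simp add: resolvent_set_def is_resolvent_def)

lemma not_in_spectrum_iff: "z \<notin> spectrum A \<longleftrightarrow> z \<in> resolvent_set A"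
  by (simp add: spectrum_def)

text \<open>Since \<open>A - w = (1 - (w - z) R) (A - z)\<close>, the resolvent at \<open>w\<close> is
  \<open>R (1 - (w - z) R)\<^sup>-\<^sup>1\<close>.\<close>

lemma resolvent_set_coercive:
  fixes A :: "('h::chilbert_space \<times> 'h) set"
  assumes R: "is_resolvent A z R" and c: "c > 0"
    and coercive: "\<And>u. Re (\<theta> * cinner (u - (w - z) *\<^sub>C R u) u) \<ge> c * (norm u)\<^sup>2"
  shows "w \<in> resolvent_set A"
proof -
  from R have blR: "bounded_linear R" and clR: "clinear_on UNIV R"
    and R1: "\<And>w. (R w, w + z *\<^sub>C R w) \<in> A" and R2: "\<And>u w. (u, w) \<in> A \<Longrightarrow> R (w - z *\<^sub>C u) = u"
    by (auto simp: is_resolvent_def)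
  note linR = linear_simps[OF blR]
  let ?T = "\<lambda>u. u - (w - z) *\<^sub>C R u"
  have "bounded_linear ?T"
    by (intro bounded_linear_sub bounded_linear_ident
        bounded_linear_compose[OF bounded_linear_scaleC blR])
  moreover have "clinear_on UNIV ?T"
    by (simp add: clinear_on_def linR clinear_on_UNIV_scaleC[OF clR] scaleC_add_right
        scaleC_diff_right scaleC_scaleC mult.commute)
  ultimately obtain Q where Q: "bounded_linear Q" "clinear_on UNIV Q"
    and TQ: "\<And>x. ?T (Q x) = x" and QT: "\<And>u. Q (?T u) = u"
    using complex_coercive_inverse[OF _ _ c coercive] by metis
  have "is_resolvent A w (\<lambda>x. R (Q x))"
    unfolding is_resolvent_def
  proof (intro conjI allI ballI)
    show "bounded_linear (\<lambda>x. R (Q x))" by (rule bounded_linear_compose[OF blR Q(1)])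
    show "clinear_on UNIV (\<lambda>x. R (Q x))"
      using clR Q(2) by (simp add: clinear_on_def)
    fix x
    have "Q x + z *\<^sub>C R (Q x) = x + w *\<^sub>C R (Q x)"
      using TQ[of x] by (simp add: scaleC_diff_left algebra_simps)
    then show "(R (Q x), x + w *\<^sub>C R (Q x)) \<in> A" using R1[of "Q x"] by simp
  next
    fix p assume "p \<in> A"
    then obtain u y where p: "p = (u, y)" "(u, y) \<in> A" by (cases p) auto
    have "y - w *\<^sub>C u = ?T (y - z *\<^sub>C u)"
      by (simp add: R2[OF p(2)] scaleC_diff_left)
    then have "R (Q (y - w *\<^sub>C u)) = u" using QT R2[OF p(2)] by metis
    then show "case p of (u, y) \<Rightarrow> R (Q (y - w *\<^sub>C u)) = u" by (simp add: p)
  qed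
  then show ?thesis by (auto simp: resolvent_set_iff)
qed

text \<open>In place of a Neumann series: if \<open>cmod (w - z) * K \<le> 1/2\<close>, where
  \<open>K\<close> bounds the resolvent \<open>R\<close> at \<open>z\<close>, then
  \<open>1 - (w - z) R\<close> is coercive with constant \<open>1/2\<close>.\<close>

lemma open_resolvent_set:
  fixes A :: "('h::chilbert_space \<times> 'h) set"
  shows "open (resolvent_set A)"
  unfolding open_contains_ball
proof
  fix z assume "z \<in> resolvent_set A"
  then obtain R where R: "is_resolvent A z R" by (auto simp: resolvent_set_iff)
  then have "bounded_linear R" by (simp add: is_resolvent_def)
  then obtain K where K: "K > 0" "\<And>u. norm (R u) \<le> norm u * K"
    using bounded_linear.pos_bounded by blast
  have "w \<in> resolvent_set A" if w: "w \<in> ball z (1 / (2 * K))" for w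
  proof (rule resolvent_set_coercive[OF R, of "1/2" 1])
    fix u :: 'h
    have "cmod (w - z) * K \<le> 1 / 2"
      using w K by (simp add: dist_norm norm_minus_commute field_simps)
    then have "cmod (w - z) * K * (norm u)\<^sup>2 \<le> 1 / 2 * (norm u)\<^sup>2"
      by (intro mult_right_mono) auto
    moreover have "cmod (cinner ((w - z) *\<^sub>C R u) u) \<le> cmod (w - z) * (norm u * K) * norm u"
      using cmod_cinner_le[of "(w - z) *\<^sub>C R u" u]
        mult_right_mono[OF mult_left_mono[OF K(2)[of u]], of "cmod (w - z)" "norm u"] by simp
    moreover have "Re (cinner ((w - z) *\<^sub>C R u) u) \<le> cmod (cinner ((w - z) *\<^sub>C R u) u)"
      by (rule complex_Re_le_cmod)
    ultimately have "Re (cinner ((w - z) *\<^sub>C R u) u) \<le> 1 / 2 * (norm u)\<^sup>2"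
      by (simp add: power2_eq_square mult_ac)
    then show "Re (1 * cinner (u - (w - z) *\<^sub>C R u) u) \<ge> 1 / 2 * (norm u)\<^sup>2"
      by (simp add: cinner_diff_left cinner_self)
  qed simp
  then show "\<exists>e>0. ball z e \<subseteq> resolvent_set A"
    using K by (intro exI[of _ "1 / (2 * K)"]) auto
qed

section \<open>Non-negative sesquilinear forms\<close>

text \<open>The discriminant criterion. For \<open>C = 0\<close> the chosen \<open>t\<close> gives
  the linear function the value \<open>-1\<close>; otherwise \<open>t = - B / C\<close> is the
  minimum point.\<close>

lemma quadratic_nonneg_imp:
  fixes A B C :: real
  assumes "\<And>t. 0 \<le> A + 2 * t * B + t\<^sup>2 * C" "C \<ge> 0"
  shows "B\<^sup>2 \<le> A * C"
proof (cases "C = 0")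
  case True
  have "B = 0"
  proof (rule ccontr)
    assume "B \<noteq> 0"
    then show False using assms(1)[of "- (A + 1) / (2 * B)"] True by (simp add: field_simps)
  qed
  then show ?thesis using True by simp
next
  case False
  then have "0 \<le> A - B\<^sup>2 / C"
    using assms(1)[of "- B / C"] by (simp add: power2_eq_square field_simps)
  then show ?thesis using False assms(2) by (simp add: field_simps)
qed

text \<open>Interpreted for \<open>h\<close> and for the energy form \<open>h1\<close> on
  \<open>H1\<close>, and for \<open>h1\<close> on the kernel of \<open>\<Gamma>\<close>.\<close>

locale nonneg_form =
  fixes a :: "'a::complex_inner \<Rightarrow> 'a \<Rightarrow> complex" and V :: "'a set"
  assumes subspace: "csubspace V" and sesquilinear: "sesquilinear_on V a"
    and nonneg: "\<And>u. u \<in> V \<Longrightarrow> a u u \<in> \<real>\<^sub>\<ge>\<^sub>0"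
begin

lemma mem_add: "u \<in> V \<Longrightarrow> v \<in> V \<Longrightarrow> u + v \<in> V"
  and mem_scaleC: "u \<in> V \<Longrightarrow> c *\<^sub>C u \<in> V"
  using subspace by (auto simp: csubspace_def)

lemmas mem_diff = csubspace_diff[OF subspace]
  and mem_scaleR = csubspace_scaleR[OF subspace]

lemma add_left: "u \<in> V \<Longrightarrow> v \<in> V \<Longrightarrow> w \<in> V \<Longrightarrow> a (u + v) w = a u w + a v w"
  and add_right: "u \<in> V \<Longrightarrow> v \<in> V \<Longrightarrow> w \<in> V \<Longrightarrow> a w (u + v) = a w u + a w v"
  and scaleC_left: "u \<in> V \<Longrightarrow> v \<in> V \<Longrightarrow> a (c *\<^sub>C u) v = c * a u v"
  and scaleC_right: "u \<in> V \<Longrightarrow> v \<in> V \<Longrightarrow> a u (c *\<^sub>C v) = cnj c * a u v"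
  using sesquilinear by (auto simp: sesquilinear_on_def)

lemma scaleR_left: "u \<in> V \<Longrightarrow> v \<in> V \<Longrightarrow> a (r *\<^sub>R u) v = r * a u v"
  and scaleR_right: "u \<in> V \<Longrightarrow> v \<in> V \<Longrightarrow> a u (r *\<^sub>R v) = r * a u v"
  by (simp_all add: scaleR_eq_scaleC scaleC_left scaleC_right)

lemma diff_left:
  assumes "u \<in> V" "v \<in> V" "w \<in> V" shows "a (u - v) w = a u w - a v w"
  using add_left[OF mem_diff[OF assms(1,2)] assms(2,3)] by simp

lemma diff_right:
  assumes "u \<in> V" "v \<in> V" "w \<in> V" shows "a w (u - v) = a w u - a w v"
  using add_right[OF mem_diff[OF assms(1,2)] assms(2,3)] by simp

lemma Im_diagonal: "u \<in> V \<Longrightarrow> Im (a u u) = 0"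
  and Re_diagonal: "u \<in> V \<Longrightarrow> Re (a u u) \<ge> 0"
  using nonneg[of u] by (auto simp: complex_nonneg_Reals_iff)

text \<open>Polarization: the diagonal is real at \<open>u + v\<close>, which settles the imaginary
  part, and at \<open>u + \<i> *\<^sub>C v\<close>, which settles the real part.\<close>

lemma hermitian:
  assumes u: "u \<in> V" and v: "v \<in> V"
  shows "a v u = cnj (a u v)"
proof (rule complex_eqI)
  have "Im (a (u + v) (u + v)) = 0" by (intro Im_diagonal mem_add u v)
  then show "Im (a v u) = Im (cnj (a u v))"
    using u v by (simp add: add_left add_right mem_add Im_diagonal)
  have "Im (a (u + \<i> *\<^sub>C v) (u + \<i> *\<^sub>C v)) = 0" by (intro Im_diagonal mem_add mem_scaleC u v)
  then show "Re (a v u) = Re (cnj (a u v))"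
    using u v
    by (simp add: add_left add_right mem_add mem_scaleC scaleC_left scaleC_right Im_diagonal)
qed

lemma expand_add_scaleR:
  assumes "u \<in> V" "v \<in> V"
  shows "Re (a (u + t *\<^sub>R v) (u + t *\<^sub>R v)) = Re (a u u) + 2 * t * Re (a u v) + t\<^sup>2 * Re (a v v)"
  using assms
  by (simp add: add_left add_right mem_add mem_scaleR scaleR_left scaleR_right hermitian[of u v]
      power2_eq_square algebra_simps)

lemma cauchy_schwarz:
  assumes "u \<in> V" "v \<in> V"
  shows "(Re (a u v))\<^sup>2 \<le> Re (a u u) * Re (a v v)"
proof (rule quadratic_nonneg_imp)
  show "0 \<le> Re (a u u) + 2 * t * Re (a u v) + t\<^sup>2 * Re (a v v)" for t
    unfolding expand_add_scaleR[OF assms, symmetric]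
    by (intro Re_diagonal mem_add mem_scaleR assms)
qed (rule Re_diagonal[OF assms(2)])

lemma restrict: "csubspace W \<Longrightarrow> W \<subseteq> V \<Longrightarrow> nonneg_form a W"
  using sesquilinear nonneg unfolding nonneg_form_def sesquilinear_on_def by blast

text \<open>The functional \<open>v \<mapsto> a v v - 2 Re (L v)\<close> is bounded below, a minimising sequence is Cauchy by
  the parallelogram identity, and its limit represents \<open>L\<close> by the first variation.\<close>

lemma riesz_representation:
  assumes complete: "\<And>x :: nat \<Rightarrow> 'a. (\<And>n. x n \<in> V) \<Longrightarrow>
      (\<And>e. e > 0 \<Longrightarrow> \<exists>N. \<forall>m\<ge>N. \<forall>n\<ge>N. Re (a (x m - x n) (x m - x n)) < e) \<Longrightarrow>
      \<exists>u\<in>V. (\<lambda>n. Re (a (x n - u) (x n - u))) \<longlonglongrightarrow> 0"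
    and L_add: "\<And>u v. u \<in> V \<Longrightarrow> v \<in> V \<Longrightarrow> L (u + v) = L u + L v"
    and L_scaleC: "\<And>c u. u \<in> V \<Longrightarrow> L (c *\<^sub>C u) = cnj c * L u"
    and K: "K \<ge> 0" and bound: "\<And>u. u \<in> V \<Longrightarrow> (Re (L u))\<^sup>2 \<le> K * Re (a u u)"
  shows "\<exists>u\<in>V. \<forall>f\<in>V. a u f = L f"
proof -
  have L_scaleR: "Re (L (r *\<^sub>R u)) = r * Re (L u)" if "u \<in> V" for r u
    using L_scaleC[OF that, of "complex_of_real r"] by (simp add: scaleR_eq_scaleC)
  define J where "J v = Re (a v v) - 2 * Re (L v)" for v
  \<comment> \<open>From \<open>4 * K * y \<le> (K + y)^2\<close> with
    \<open>y = Re (a v v)\<close>.\<close>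
  have J_ge: "J v \<ge> - K" if v: "v \<in> V" for v
  proof -
    have "(2 * Re (L v))\<^sup>2 \<le> (K + Re (a v v))\<^sup>2"
      using bound[OF v] zero_le_power2[of "K - Re (a v v)"]
      by (simp add: power2_eq_square algebra_simps)
    then have "2 * Re (L v) \<le> K + Re (a v v)"
      by (rule power2_le_imp_le) (use K Re_diagonal[OF v] in simp)
    then show ?thesis by (simp add: J_def)
  qed
  define m where "m = Inf (J ` V)"
  have bdd: "bdd_below (J ` V)" using J_ge by (intro bdd_belowI2)
  have m_le: "m \<le> J v" if "v \<in> V" for v
    unfolding m_def using bdd that by (intro cInf_lower) auto
  have ne: "J ` V \<noteq> {}" using subspace by (auto simp: csubspace_def)
  have "\<exists>v\<in>V. J v < m + e" if "e > 0" for e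
    using cInf_less_iff[OF ne bdd, of "m + e"] that by (auto simp: m_def)
  then have "\<forall>n. \<exists>v\<in>V. J v < m + inverse (real (Suc n))" by simp
  then obtain x where x: "\<And>n. x n \<in> V" "\<And>n. J (x n) < m + inverse (real (Suc n))"
    by metis
  have parallelogram:
    "Re (a (u - v) (u - v)) = 2 * J u + 2 * J v - 4 * J ((1 / 2) *\<^sub>R (u + v))"
    if "u \<in> V" "v \<in> V" for u v
  proof -
    let ?w = "(1 / 2) *\<^sub>R (u + v)"
    have "Re (L ?w) = (Re (L u) + Re (L v)) / 2"
      using that by (simp add: L_scaleR mem_add L_add)
    moreover have "4 * Re (a ?w ?w) = Re (a (u + v) (u + v))"
      using that by (simp add: scaleR_left scaleR_right mem_add mem_scaleR)
    moreover have "Re (a (u + v) (u + v)) + Re (a (u - v) (u - v)) = 2 * Re (a u u) + 2 * Re (a v v)"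
      using that by (simp add: add_left add_right diff_left diff_right mem_add mem_diff)
    ultimately show ?thesis by (simp add: J_def)
  qed
  have "\<exists>u\<in>V. (\<lambda>n. Re (a (x n - u) (x n - u))) \<longlonglongrightarrow> 0"
  proof (rule complete[OF x(1)])
    fix e :: real assume "e > 0"
    then obtain N where N: "inverse (real (Suc N)) < e / 4"
      using reals_Archimedean[of "e / 4"] by auto
    show "\<exists>N. \<forall>m\<ge>N. \<forall>n\<ge>N. Re (a (x m - x n) (x m - x n)) < e"
    proof (intro exI[of _ N] allI impI)
      fix i j assume "i \<ge> N" "j \<ge> N"
      then have "inverse (real (Suc i)) \<le> inverse (real (Suc N))"
        "inverse (real (Suc j)) \<le> inverse (real (Suc N))"
        by (intro le_imp_inverse_le; simp)+
      \<comment> \<open>The parallelogram identity yields less than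
        \<open>4 * (m + e / 4) - 4 * m = e\<close>, because \<open>J\<close> at the midpoint is at
        least \<open>m\<close>.\<close>
      then have "J (x i) < m + e / 4" "J (x j) < m + e / 4"
        using x(2)[of i] x(2)[of j] N by linarith+
      moreover have "m \<le> J ((1 / 2) *\<^sub>R (x i + x j))"
        by (intro m_le mem_scaleR mem_add x)
      ultimately show "Re (a (x i - x j) (x i - x j)) < e"
        unfolding parallelogram[OF x(1) x(1)] by linarith
    qed
  qed
  then obtain u where u: "u \<in> V" "(\<lambda>n. Re (a (x n - u) (x n - u))) \<longlonglongrightarrow> 0" by blast
  \<comment> \<open>Cauchy-Schwarz turns convergence in the seminorm of \<open>a\<close> into
    convergence against each fixed \<open>f\<close>.\<close>
  have lim: "(\<lambda>n. Re (a (x n) f)) \<longlonglongrightarrow> Re (a u f)" if f: "f \<in> V" for f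
  proof -
    have "(\<lambda>n. (Re (a (x n - u) f))\<^sup>2) \<longlonglongrightarrow> 0"
    proof (rule tendsto_sandwich[OF _ _ tendsto_const])
      show "(\<lambda>n. Re (a (x n - u) (x n - u)) * Re (a f f)) \<longlonglongrightarrow> 0"
        by (rule tendsto_mult_left_zero[OF u(2)])
      show "\<forall>\<^sub>F n in sequentially.
          (Re (a (x n - u) f))\<^sup>2 \<le> Re (a (x n - u) (x n - u)) * Re (a f f)"
        by (intro always_eventually allI cauchy_schwarz mem_diff x u(1) f)
    qed simp
    then have "(\<lambda>n. Re (a (x n - u) f)) \<longlonglongrightarrow> 0"
      by (simp add: power_tendsto_0_iff)
    then show ?thesis
      using u(1) x(1) f by (simp add: diff_left LIM_zero_iff)
  qed
  have Re_eq: "Re (a u f) = Re (L f)" if f: "f \<in> V" for f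
  proof -
    \<comment> \<open>The variation is taken at \<open>x n\<close>, where \<open>J\<close> exceeds
      its infimum by less than \<open>inverse (real (Suc n))\<close>, and only then \<open>n\<close>
      tends to infinity. The vanishing constant term forces the linear coefficient to be
      zero.\<close>
    have "0 \<le> 0 + 2 * t * (Re (a u f) - Re (L f)) + t\<^sup>2 * Re (a f f)" for t
    proof (rule tendsto_lowerbound)
      show "(\<lambda>n. inverse (real (Suc n)) + 2 * t * (Re (a (x n) f) - Re (L f)) + t\<^sup>2 * Re (a f f))
          \<longlonglongrightarrow> 0 + 2 * t * (Re (a u f) - Re (L f)) + t\<^sup>2 * Re (a f f)"
        by (intro tendsto_intros lim f LIMSEQ_inverse_real_of_nat)
      show "\<forall>\<^sub>F n in sequentially. 0 \<le>
          inverse (real (Suc n)) + 2 * t * (Re (a (x n) f) - Re (L f)) + t\<^sup>2 * Re (a f f)"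
      proof (intro always_eventually allI)
        fix n
        have "J (x n + t *\<^sub>R f) =
            J (x n) + 2 * t * (Re (a (x n) f) - Re (L f)) + t\<^sup>2 * Re (a f f)"
          using x(1) f
          by (simp add: J_def expand_add_scaleR L_add mem_scaleR L_scaleR algebra_simps)
        moreover have "m \<le> J (x n + t *\<^sub>R f)"
          by (intro m_le mem_add mem_scaleR x f)
        ultimately show "0 \<le>
            inverse (real (Suc n)) + 2 * t * (Re (a (x n) f) - Re (L f)) + t\<^sup>2 * Re (a f f)"
          using x(2)[of n] by linarith
      qed
    qed simp
    from quadratic_nonneg_imp[OF this Re_diagonal[OF f]] show ?thesis by simp
  qed
  show ?thesis
  proof (intro bexI[OF _ u(1)] ballI complex_eqI)
    fix f assume f: "f \<in> V"
    show "Re (a u f) = Re (L f)" by (rule Re_eq[OF f])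
    \<comment> \<open>Both sides are antilinear in \<open>f\<close>, so the real parts at
      \<open>\<i> *\<^sub>C f\<close> give the imaginary parts at \<open>f\<close>.\<close>
    show "Im (a u f) = Im (L f)"
      using Re_eq[OF mem_scaleC[OF f, of \<i>]] f u(1) by (simp add: scaleC_right L_scaleC)
  qed
qed

end

section \<open>Solution operators of a boundary pair\<close>

locale form_with_boundary_pair =
  fixes h :: "'h::chilbert_space \<Rightarrow> 'h \<Rightarrow> complex"
    and H1 :: "'h set"
    and \<Gamma> :: "'h \<Rightarrow> 'g::chilbert_space"
  assumes closed_form: "closed_nonneg_form h H1"
    and boundary_pair: "boundary_pair h H1 \<Gamma>"
begin

abbreviation "V \<equiv> ker_on H1 \<Gamma>"
abbreviation "A \<equiv> dirichlet_operator h H1 \<Gamma>"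
abbreviation "S \<equiv> solution_operator h H1 \<Gamma>"
abbreviation "N \<equiv> weak_solutions h H1 \<Gamma>"

text \<open>The inner product belonging to the form norm. Orthogonality to \<open>V\<close> with
  respect to it is the weak equation at \<open>z = -1\<close>.\<close>

definition h1 :: "'h \<Rightarrow> 'h \<Rightarrow> complex"
  where "h1 u v = h u v + cinner u v"

sublocale form: nonneg_form h H1
  using closed_form by unfold_locales (auto simp: closed_nonneg_form_def)

lemma clinear_\<Gamma>: "clinear_on H1 \<Gamma>"
  using boundary_pair by (simp add: boundary_pair_def)

lemma \<Gamma>_add: "u \<in> H1 \<Longrightarrow> v \<in> H1 \<Longrightarrow> \<Gamma> (u + v) = \<Gamma> u + \<Gamma> v"
  and \<Gamma>_scaleC: "u \<in> H1 \<Longrightarrow> \<Gamma> (c *\<^sub>C u) = c *\<^sub>C \<Gamma> u"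
  using clinear_\<Gamma> by (auto simp: clinear_on_def)

lemmas \<Gamma>_diff = clinear_on_diff[OF form.subspace clinear_\<Gamma>]

lemma V_subset: "u \<in> V \<Longrightarrow> u \<in> H1"
  by (simp add: ker_on_def)

lemma csubspace_V: "csubspace V"
proof -
  have "(0::'h) \<in> H1" using form.subspace by (simp add: csubspace_def)
  moreover from this have "\<Gamma> 0 = 0" using \<Gamma>_diff[of 0 0] by simp
  ultimately show ?thesis
    by (auto simp: csubspace_def ker_on_def \<Gamma>_add \<Gamma>_scaleC form.mem_add form.mem_scaleC)
qed

sublocale energy: nonneg_form h1 H1
proof
  show "csubspace H1" by (rule form.subspace)
  show "sesquilinear_on H1 h1"
    unfolding sesquilinear_on_def
    by (simp add: h1_def form.add_left form.add_right form.scaleC_left form.scaleC_right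
        cinner_add_left cinner_add_right cinner_scaleC_left cinner_scaleC_right algebra_simps)
  fix u assume "u \<in> H1"
  then show "h1 u u \<in> \<real>\<^sub>\<ge>\<^sub>0"
    by (simp add: h1_def cinner_self form.nonneg nonneg_Reals_add_I)
qed

sublocale dirichlet: nonneg_form h1 V
  by (intro energy.restrict csubspace_V subsetI V_subset)

lemma form_norm_eq: "form_norm h u = sqrt (Re (h1 u u))"
  by (simp add: form_norm_def h1_def cinner_self)

lemma norm_le_form: "u \<in> H1 \<Longrightarrow> (norm u)\<^sup>2 \<le> Re (h1 u u)"
  using form.Re_diagonal[of u] by (simp add: h1_def cinner_self)

text \<open>The kernel is closed in the form norm: a limit \<open>u\<close> exists in
  \<open>H1\<close>, and \<open>\<Gamma> (x n) = 0\<close> bounds \<open>norm (\<Gamma> u)\<close>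
  by a multiple of \<open>form_norm h (x n - u)\<close>, which tends to zero.\<close>

lemma complete_V:
  fixes x :: "nat \<Rightarrow> 'h"
  assumes x: "\<And>n. x n \<in> V"
    and cauchy: "\<And>e. e > 0 \<Longrightarrow> \<exists>M. \<forall>m\<ge>M. \<forall>n\<ge>M. Re (h1 (x m - x n) (x m - x n)) < e"
  shows "\<exists>u\<in>V. (\<lambda>n. Re (h1 (x n - u) (x n - u))) \<longlonglongrightarrow> 0"
proof -
  have "\<exists>M. \<forall>m\<ge>M. \<forall>n\<ge>M. form_norm h (x m - x n) < e" if "e > 0" for e
    using cauchy[of "e\<^sup>2"] that unfolding form_norm_eq
    by (metis real_sqrt_less_iff real_sqrt_unique less_imp_le zero_less_power)
  then obtain u where u: "u \<in> H1" "(\<lambda>n. form_norm h (x n - u)) \<longlonglongrightarrow> 0"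
    using closed_form x V_subset unfolding closed_nonneg_form_def by blast
  obtain C where C: "\<And>u. u \<in> H1 \<Longrightarrow> norm (\<Gamma> u) \<le> C * form_norm h u"
    using boundary_pair by (auto simp: boundary_pair_def)
  have "norm (\<Gamma> u) \<le> C * form_norm h (x n - u)" for n
    using C[of "x n - u"] x[of n] u(1) by (simp add: ker_on_def \<Gamma>_diff form.mem_diff)
  moreover have "(\<lambda>n. C * form_norm h (x n - u)) \<longlonglongrightarrow> C * 0"
    by (intro tendsto_intros u)
  ultimately have "norm (\<Gamma> u) \<le> C * 0"
    by (intro tendsto_lowerbound[where F = sequentially]) auto
  then have "u \<in> V" using u(1) by (simp add: ker_on_def)
  moreover have "(\<lambda>n. (form_norm h (x n - u))\<^sup>2) \<longlonglongrightarrow> 0\<^sup>2"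
    by (intro tendsto_intros u)
  ultimately show ?thesis
    using x u(1) by (intro bexI[of _ u])
      (simp_all add: form_norm_eq energy.Re_diagonal form.mem_diff V_subset)
qed

lemma V_orthogonal_imp_zero:
  assumes "u \<in> V" "\<And>f. f \<in> V \<Longrightarrow> h1 u f = 0" shows "u = 0"
  using norm_le_form[OF V_subset[OF assms(1)]] assms(2)[OF assms(1)] by simp

section \<open>The Dirichlet resolvent\<close>

lemma dirichlet_operator_iff: "(u, w) \<in> A \<longleftrightarrow> u \<in> V \<and> (\<forall>f\<in>V. h u f = cinner w f)"
  by (simp add: dirichlet_operator_def form_operator_def)

text \<open>Riesz representation of \<open>cinner g\<close> in \<open>V\<close> with the energy
  inner product defines \<open>R g\<close>. That \<open>cinner (R u) u\<close> is real is recorded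
  for the passage to non-real points.\<close>

lemma resolvent_minus_one:
  obtains R where "is_resolvent A (-1) R" "\<And>u. Im (cinner (R u) u) = 0"
proof -
  have "\<exists>v\<in>V. \<forall>f\<in>V. h1 v f = cinner g f" for g
  proof (rule dirichlet.riesz_representation[OF complete_V, of "cinner g" "(norm g)\<^sup>2"])
    fix u assume u: "u \<in> V"
    have "\<bar>Re (cinner g u)\<bar> \<le> norm g * norm u"
      using abs_Re_le_cmod cmod_cinner_le order_trans by blast
    then have "(Re (cinner g u))\<^sup>2 \<le> (norm g)\<^sup>2 * (norm u)\<^sup>2"
      unfolding power_mult_distrib[symmetric] by (rule power2_le_iff_abs_le[THEN iffD2, rotated]) simp
    also have "\<dots> \<le> (norm g)\<^sup>2 * Re (h1 u u)"
      using norm_le_form[OF V_subset[OF u]] by (intro mult_left_mono) auto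
    finally show "(Re (cinner g u))\<^sup>2 \<le> (norm g)\<^sup>2 * Re (h1 u u)" .
  qed (simp_all add: cinner_add_right cinner_scaleC_right)
  then obtain R where R: "\<And>g. R g \<in> V" "\<And>g f. f \<in> V \<Longrightarrow> h1 (R g) f = cinner g f"
    by metis
  \<comment> \<open>Linearity of \<open>R\<close> and the fact that it inverts the operator on its
    domain both follow from this uniqueness.\<close>
  have unique: "R g = v" if "v \<in> V" "\<And>f. f \<in> V \<Longrightarrow> h1 v f = cinner g f" for g v
  proof -
    have "R g - v = 0"
    proof (rule V_orthogonal_imp_zero)
      show "R g - v \<in> V" by (intro dirichlet.mem_diff R that)
      show "h1 (R g - v) f = 0" if "f \<in> V" for f
        using dirichlet.diff_left[OF R(1)[of g] \<open>v \<in> V\<close> that] R(2)[OF that]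
          \<open>\<And>f. f \<in> V \<Longrightarrow> h1 v f = cinner g f\<close>[OF that] by simp
    qed
    then show ?thesis by simp
  qed
  have add: "R (x + y) = R x + R y" for x y
    using R(2) by (intro unique)
      (simp_all add: dirichlet.mem_add R(1) dirichlet.add_left cinner_add_left)
  have scale: "R (c *\<^sub>C x) = c *\<^sub>C R x" for c x
    using R(2) by (intro unique)
      (simp_all add: dirichlet.mem_scaleC R(1) dirichlet.scaleC_left cinner_scaleC_left)
  have bound: "norm (R g) \<le> 1 * norm g" for g
  proof (cases "R g = 0")
    case False
    have "(norm (R g))\<^sup>2 \<le> Re (h1 (R g) (R g))" by (intro norm_le_form V_subset R)
    also have "\<dots> = Re (cinner g (R g))" by (simp only: R)
    also have "\<dots> \<le> norm g * norm (R g)"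
      using complex_Re_le_cmod cmod_cinner_le order_trans by blast
    finally show ?thesis using False by (simp add: power2_eq_square)
  qed simp
  have "is_resolvent A (-1) R"
    unfolding is_resolvent_def
  proof (intro conjI bounded_clinearI[OF add scale bound] allI ballI)
    fix g
    show "(R g, g + (- 1) *\<^sub>C R g) \<in> A"
      using R(1)[of g] R(2)[of _ g]
      by (simp add: dirichlet_operator_iff h1_def scaleC_minus_left cinner_diff_left eq_diff_eq)
  next
    fix p assume "p \<in> A"
    then show "case p of (u, w) \<Rightarrow> R (w - (- 1) *\<^sub>C u) = u"
      by (cases p) (auto intro!: unique
          simp: dirichlet_operator_iff h1_def scaleC_minus_left cinner_add_left)
  qed
  moreover have "Im (cinner (R u) u) = 0" for u
  proof -
    have "cinner (R u) u = cnj (h1 (R u) (R u))"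
      by (subst cinner_commute) (simp only: R)
    then show ?thesis using dirichlet.Im_diagonal[OF R(1)[of u]] by simp
  qed
  ultimately show thesis by (rule that)
qed

lemma minus_one_in_resolvent_set: "-1 \<in> resolvent_set A"
  using resolvent_minus_one resolvent_set_iff by metis

text \<open>Multiplying \<open>1 - (z + 1) R\<close> by \<open>1 / (z + 1)\<close> turns it into a non-real number minus a
  symmetric operator.\<close>

lemma nonreal_in_resolvent_set:
  assumes "Im z \<noteq> 0" shows "z \<in> resolvent_set A"
proof -
  obtain R where R: "is_resolvent A (-1) R" and real: "\<And>u. Im (cinner (R u) u) = 0"
    using resolvent_minus_one by blast
  define \<zeta> where "\<zeta> = z - (-1)"
  \<comment> \<open>The sign makes \<open>- s * Im (1 / \<zeta>)\<close> positive; the factor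
    \<open>\<i>\<close> in the rotation used below moves this imaginary part into the real part,
    where the real \<open>cinner (R u) u\<close> drops out.\<close>
  define s where "s = - sgn (Im (1 / \<zeta>))"
  have "Im \<zeta> \<noteq> 0" using assms by (simp add: \<zeta>_def)
  then have \<zeta>: "\<zeta> \<noteq> 0" "Im (1 / \<zeta>) \<noteq> 0" by (auto simp: Im_divide complex_eq_iff sum_power2_eq_zero_iff)
  show ?thesis
  proof (rule resolvent_set_coercive[OF R, of "\<bar>Im (1 / \<zeta>)\<bar>" "\<i> * s / \<zeta>"])
    fix u :: 'h
    let ?n = "complex_of_real ((norm u)\<^sup>2)"
    have "\<i> * s / \<zeta> * cinner (u - \<zeta> *\<^sub>C R u) u = \<i> * s * (1 / \<zeta> * ?n - cinner (R u) u)"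
      using \<zeta> by (simp add: cinner_diff_left cinner_scaleC_left cinner_self field_simps)
    moreover have "Re (\<i> * complex_of_real s * (y * complex_of_real r - x)) = - s * Im y * r"
      if "Im x = 0" for x y r
      using that by simp
    ultimately have
      "Re (\<i> * s / \<zeta> * cinner (u - \<zeta> *\<^sub>C R u) u) = - s * Im (1 / \<zeta>) * (norm u)\<^sup>2"
      using real[of u] by metis
    also have "- s * Im (1 / \<zeta>) = \<bar>Im (1 / \<zeta>)\<bar>"
      by (simp add: s_def abs_sgn)
    finally show "Re (\<i> * s / \<zeta> * cinner (u - (z - - 1) *\<^sub>C R u) u) \<ge> \<bar>Im (1 / \<zeta>)\<bar> * (norm u)\<^sup>2"
      unfolding \<zeta>_def by simp
  qed (use \<zeta> in simp)
qed

section \<open>Weak solutions and the solution operator\<close>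

lemma weak_solutions_iff: "u \<in> N z \<longleftrightarrow> u \<in> H1 \<and> (\<forall>f\<in>V. h u f = z * cinner u f)"
  by (simp add: weak_solutions_def)

text \<open>\<open>R u\<close> lies in \<open>ker \<Gamma>\<close> and solves the inhomogeneous
  equation at \<open>z\<close> with right-hand side \<open>u\<close>, so adding
  \<open>(z - w) *\<^sub>C R u\<close> changes the parameter from \<open>w\<close> to
  \<open>z\<close> and keeps the boundary value.\<close>

lemma weak_solution_shift:
  assumes R: "is_resolvent A z R" and u: "u \<in> N w"
  shows "u + (z - w) *\<^sub>C R u \<in> N z" "\<Gamma> (u + (z - w) *\<^sub>C R u) = \<Gamma> u"
proof -
  have "(R u, u + z *\<^sub>C R u) \<in> A" using R by (simp add: is_resolvent_def)
  then have Ru: "R u \<in> V" "\<And>f. f \<in> V \<Longrightarrow> h (R u) f = cinner u f + z * cinner (R u) f"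
    by (auto simp: dirichlet_operator_iff cinner_add_left cinner_scaleC_left)
  have u': "u \<in> H1" "\<And>f. f \<in> V \<Longrightarrow> h u f = w * cinner u f"
    using u by (auto simp: weak_solutions_iff)
  show "\<Gamma> (u + (z - w) *\<^sub>C R u) = \<Gamma> u"
    using Ru(1) u'(1) \<Gamma>_scaleC[of "R u" "z - w"]
    by (simp add: \<Gamma>_add ker_on_def form.mem_scaleC)
  show "u + (z - w) *\<^sub>C R u \<in> N z"
    unfolding weak_solutions_iff
    using Ru u' V_subset
    by (auto simp: form.mem_add form.mem_scaleC form.add_left form.scaleC_left cinner_add_left
        cinner_scaleC_left algebra_simps)
qed

text \<open>The difference lies in \<open>V\<close> and satisfies the eigenvalue equation of the
  Dirichlet operator at \<open>z\<close>; the resolvent sends zero back to it.\<close>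

lemma weak_solution_unique:
  assumes z: "z \<in> resolvent_set A" and uv: "u \<in> N z" "v \<in> N z" "\<Gamma> u = \<Gamma> v"
  shows "u = v"
proof -
  obtain R where R: "is_resolvent A z R" using z by (auto simp: resolvent_set_iff)
  have uvH: "u \<in> H1" "v \<in> H1" using uv by (auto simp: weak_solutions_iff)
  have "u - v \<in> V" using uvH uv(3) by (simp add: ker_on_def \<Gamma>_diff form.mem_diff)
  moreover have "h (u - v) f = z * cinner (u - v) f" if f: "f \<in> V" for f
    using uv f V_subset[OF f] uvH
    by (simp add: weak_solutions_iff form.diff_left cinner_diff_left algebra_simps)
  ultimately have "(u - v, z *\<^sub>C (u - v)) \<in> A"
    by (simp add: dirichlet_operator_iff cinner_scaleC_left)
  then have "R (z *\<^sub>C (u - v) - z *\<^sub>C (u - v)) = u - v"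
    using R by (auto simp: is_resolvent_def)
  moreover have "R 0 = 0"
    using R by (simp add: is_resolvent_def linear_simps)
  ultimately show ?thesis by simp
qed

text \<open>The weak solution for \<open>z = -1\<close> is the component of \<open>u\<close> orthogonal to the kernel of
  \<open>\<Gamma>\<close> in the form inner product.\<close>

lemma weak_solution_minus_one:
  assumes u: "u \<in> H1" shows "\<exists>v\<in>N (-1). \<Gamma> v = \<Gamma> u"
proof -
  have "\<exists>v\<in>V. \<forall>f\<in>V. h1 v f = h1 u f"
    by (rule dirichlet.riesz_representation[OF complete_V, of "h1 u" "Re (h1 u u)"])
      (simp_all add: energy.add_right energy.scaleC_right energy.cauchy_schwarz energy.Re_diagonal u V_subset)
  then obtain v where v: "v \<in> V" "\<And>f. f \<in> V \<Longrightarrow> h1 v f = h1 u f" by blast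
  have "u - v \<in> N (-1)"
    unfolding weak_solutions_iff
    using u v V_subset
    by (auto simp: h1_def form.mem_diff form.diff_left cinner_diff_left algebra_simps)
  moreover have "\<Gamma> (u - v) = \<Gamma> u"
    using u v(1) by (simp add: \<Gamma>_diff ker_on_def)
  ultimately show ?thesis by blast
qed

text \<open>A solution at \<open>-1\<close> is carried to \<open>z\<close> by the shift, so
  \<open>\<phi>\<close> lies in the image of \<open>N z\<close> and \<open>inv_into\<close> returns
  a true preimage.\<close>

lemma solution_operator_mem:
  assumes z: "z \<in> resolvent_set A" and \<phi>: "\<phi> \<in> \<Gamma> ` H1"
  shows "S z \<phi> \<in> N z" "\<Gamma> (S z \<phi>) = \<phi>"
proof -
  obtain R where R: "is_resolvent A z R" using z by (auto simp: resolvent_set_iff)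
  obtain u where "u \<in> N (-1)" "\<Gamma> u = \<phi>" using \<phi> weak_solution_minus_one by blast
  with weak_solution_shift[OF R] have "\<phi> \<in> \<Gamma> ` N z" by (metis imageI)
  then show "S z \<phi> \<in> N z" "\<Gamma> (S z \<phi>) = \<phi>"
    by (simp_all add: solution_operator_def inv_into_into f_inv_into_f)
qed

lemma solution_operator_eqI:
  assumes "z \<in> resolvent_set A" "u \<in> N z" "\<Gamma> u = \<phi>"
  shows "S z \<phi> = u"
proof (rule weak_solution_unique[OF assms(1)])
  have "\<phi> \<in> \<Gamma> ` H1" using assms(2,3) by (auto simp: weak_solutions_iff)
  from solution_operator_mem[OF assms(1) this]
  show "S z \<phi> \<in> N z" "\<Gamma> (S z \<phi>) = \<Gamma> u" using assms(3) by simp_all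
qed (rule assms)

lemma solution_operator_shift:
  assumes R: "is_resolvent A z R" and w: "w \<in> resolvent_set A" and \<phi>: "\<phi> \<in> \<Gamma> ` H1"
  shows "S z \<phi> = S w \<phi> + (z - w) *\<^sub>C R (S w \<phi>)"
  using R weak_solution_shift[OF R solution_operator_mem(1)[OF w \<phi>]]
    solution_operator_mem(2)[OF w \<phi>]
  by (intro solution_operator_eqI) (auto simp: resolvent_set_iff)

lemma norm_solution_operator_le:
  assumes z: "z \<in> resolvent_set A" and w: "w \<in> resolvent_set A"
  shows "\<exists>C>0. \<forall>\<phi>\<in>\<Gamma> ` H1. norm (S z \<phi>) \<le> C * norm (S w \<phi>)"
proof -
  obtain R where R: "is_resolvent A z R" using z by (auto simp: resolvent_set_iff)
  then have "bounded_linear R" by (simp add: is_resolvent_def)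
  then obtain K where K: "K > 0" "\<And>u. norm (R u) \<le> norm u * K"
    using bounded_linear.pos_bounded by blast
  show ?thesis
  proof (intro exI[of _ "1 + cmod (z - w) * K"] conjI ballI)
    show "1 + cmod (z - w) * K > 0" using K(1) by (simp add: add_pos_nonneg)
    fix \<phi> assume \<phi>: "\<phi> \<in> \<Gamma> ` H1"
    have "norm (S z \<phi>) \<le> norm (S w \<phi>) + cmod (z - w) * norm (R (S w \<phi>))"
      unfolding solution_operator_shift[OF R w \<phi>] norm_scaleC[symmetric] by (rule norm_triangle_ineq)
    also have "\<dots> \<le> norm (S w \<phi>) + cmod (z - w) * (norm (S w \<phi>) * K)"
      by (intro add_left_mono mult_left_mono K) simp
    finally show "norm (S z \<phi>) \<le> (1 + cmod (z - w) * K) * norm (S w \<phi>)"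
      by (simp add: algebra_simps)
  qed
qed

section \<open>The Dirichlet-to-Neumann form and its derivative\<close>

text \<open>Changing \<open>w\<close> alters \<open>S w \<psi>\<close> by an element of \<open>ker \<Gamma>\<close>, so any \<open>w\<close> may replace the
  \<open>-1\<close> of the definition.\<close>

lemma dn_form_eq:
  assumes z: "z \<in> resolvent_set A" and w: "w \<in> resolvent_set A"
    and \<phi>: "\<phi> \<in> \<Gamma> ` H1" and \<psi>: "\<psi> \<in> \<Gamma> ` H1"
  shows "dn_form h H1 \<Gamma> z \<phi> \<psi> = h (S z \<phi>) (S w \<psi>) - z * cinner (S z \<phi>) (S w \<psi>)"
proof -
  let ?u = "S z \<phi>" and ?v = "S (-1) \<psi>" and ?v' = "S w \<psi>"
  note mem = solution_operator_mem[OF z \<phi>] solution_operator_mem[OF w \<psi>]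
    solution_operator_mem[OF minus_one_in_resolvent_set \<psi>]
  then have H1: "?u \<in> H1" "?v \<in> H1" "?v' \<in> H1" by (auto simp: weak_solutions_iff)
  then have "?v - ?v' \<in> V" using mem by (simp add: ker_on_def \<Gamma>_diff form.mem_diff)
  then have "h ?u (?v - ?v') = z * cinner ?u (?v - ?v')"
    using mem(1) by (simp add: weak_solutions_iff)
  then show ?thesis
    using H1 by (simp add: dn_form_def Let_def form.diff_right cinner_diff_right algebra_simps)
qed

lemma dn_form_diagonal:
  assumes "z \<in> resolvent_set A" "\<phi> \<in> \<Gamma> ` H1"
  shows "dn_form h H1 \<Gamma> z \<phi> \<phi> = h (S z \<phi>) (S z \<phi>) - z * complex_of_real ((norm (S z \<phi>))\<^sup>2)"
  using dn_form_eq[OF assms(1,1,2,2)] by (simp add: cinner_self)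

lemma form_Im_dn_form:
  assumes z: "z \<in> resolvent_set A" and \<phi>: "\<phi> \<in> \<Gamma> ` H1"
  shows "form_Im (dn_form h H1 \<Gamma> z) \<phi> \<phi> = - complex_of_real (Im z * (norm (S z \<phi>))\<^sup>2)"
proof -
  have "S z \<phi> \<in> H1" using solution_operator_mem[OF z \<phi>] by (simp add: weak_solutions_iff)
  then have "Im (dn_form h H1 \<Gamma> z \<phi> \<phi>) = - (Im z * (norm (S z \<phi>))\<^sup>2)"
    by (simp add: dn_form_diagonal[OF z \<phi>] form.Im_diagonal)
  moreover have "form_Im (dn_form h H1 \<Gamma> z) \<phi> \<phi> = complex_of_real (Im (dn_form h H1 \<Gamma> z \<phi> \<phi>))"
    by (simp add: form_Im_def form_adjoint_def complex_diff_cnj complex_eq_iff)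
  ultimately show ?thesis by simp
qed

text \<open>The shift formula is used with the fixed resolvent at \<open>z\<close>, so its
  correction term contains \<open>S w \<phi>\<close>. For \<open>w\<close> within
  \<open>1 / (2 * K)\<close> of \<open>z\<close> that term is absorbed, and the difference is at
  most a constant times \<open>cmod (w - z)\<close>.\<close>

lemma solution_operator_continuous:
  assumes z: "z \<in> resolvent_set A" and \<phi>: "\<phi> \<in> \<Gamma> ` H1"
  shows "((\<lambda>w. S w \<phi>) \<longlongrightarrow> S z \<phi>) (at z)"
proof -
  obtain R where R: "is_resolvent A z R" using z by (auto simp: resolvent_set_iff)
  then have "bounded_linear R" by (simp add: is_resolvent_def)
  then obtain K where K: "K > 0" "\<And>u. norm (R u) \<le> norm u * K"
    using bounded_linear.pos_bounded by blast
  let ?B = "2 * K * norm (S z \<phi>)"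
  have "\<forall>\<^sub>F w in at z. norm (S w \<phi> - S z \<phi>) \<le> ?B * cmod (w - z)"
  proof (rule eventually_mono[OF eventually_conj])
    show "\<forall>\<^sub>F w in at z. w \<in> resolvent_set A"
      by (rule topological_tendstoD[OF tendsto_ident_at open_resolvent_set z])
    show "\<forall>\<^sub>F w in at z. dist w z < 1 / (2 * K)"
      by (rule tendstoD[OF tendsto_ident_at]) (use K in simp)
    fix w assume w: "w \<in> resolvent_set A \<and> dist w z < 1 / (2 * K)"
    then have "S z \<phi> = S w \<phi> + (z - w) *\<^sub>C R (S w \<phi>)"
      by (intro solution_operator_shift R \<phi>) simp
    then have "S z \<phi> - S w \<phi> = (z - w) *\<^sub>C R (S w \<phi>)"
      by (simp only: add_diff_cancel_left')
    then have "norm (S w \<phi> - S z \<phi>) = cmod (w - z) * norm (R (S w \<phi>))"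
      by (metis norm_minus_commute norm_scaleC)
    also have "\<dots> \<le> cmod (w - z) * (norm (S w \<phi>) * K)"
      by (intro mult_left_mono K) simp
    finally have diff: "norm (S w \<phi> - S z \<phi>) \<le> cmod (w - z) * K * norm (S w \<phi>)"
      by (simp add: mult_ac)
    \<comment> \<open>Absorption: half of \<open>norm (S w \<phi>)\<close> moves to the left-hand
      side, which bounds it by \<open>2 * norm (S z \<phi>)\<close>.\<close>
    also have "\<dots> \<le> 1 / 2 * norm (S w \<phi>)"
    proof (rule mult_right_mono)
      show "cmod (w - z) * K \<le> 1 / 2"
        using w K(1) by (simp add: dist_norm field_simps)
    qed simp
    finally have "norm (S w \<phi>) \<le> 2 * norm (S z \<phi>)"
      using norm_triangle_ineq2[of "S w \<phi>" "S z \<phi>"] by simp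
    then have "cmod (w - z) * K * norm (S w \<phi>) \<le> cmod (w - z) * K * (2 * norm (S z \<phi>))"
      using K by (intro mult_left_mono) auto
    with diff show "norm (S w \<phi> - S z \<phi>) \<le> ?B * cmod (w - z)" by (simp add: mult_ac)
  qed
  moreover have "((\<lambda>w. ?B * cmod (w - z)) \<longlongrightarrow> ?B * cmod (z - z)) (at z)"
    by (intro tendsto_intros)
  ultimately have "((\<lambda>w. S w \<phi> - S z \<phi>) \<longlongrightarrow> 0) (at z)"
    using Lim_null_comparison by force
  then show ?thesis by (simp add: LIM_zero_iff)
qed

text \<open>By symmetry of \<open>h\<close> and reality of \<open>x\<close>, the difference quotient of the form at \<open>x\<close> is
  \<open>- cinner (S w \<phi>) (S x \<phi>)\<close>.\<close>

lemma dn_form_deriv_real: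
  fixes x :: real
  assumes x: "complex_of_real x \<in> resolvent_set A" and \<phi>: "\<phi> \<in> \<Gamma> ` H1"
  shows "dn_form_deriv h H1 \<Gamma> x \<phi> \<phi> = - complex_of_real ((norm (S x \<phi>))\<^sup>2)"
  unfolding dn_form_deriv_def
proof (rule DERIV_imp_deriv)
  let ?l = "\<lambda>w. dn_form h H1 \<Gamma> w \<phi> \<phi>" and ?z = "complex_of_real x"
  have "\<forall>\<^sub>F w in at ?z. - cinner (S w \<phi>) (S ?z \<phi>) = (?l w - ?l ?z) / (w - ?z)"
  proof (rule eventually_mono[OF eventually_conj])
    show "\<forall>\<^sub>F w in at ?z. w \<in> resolvent_set A"
      by (rule topological_tendstoD[OF tendsto_ident_at open_resolvent_set x])
    show "\<forall>\<^sub>F w in at ?z. w \<noteq> ?z" by (simp add: eventually_at_filter)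
    fix w assume w: "w \<in> resolvent_set A \<and> w \<noteq> ?z"
    let ?u = "S w \<phi>" and ?v = "S ?z \<phi>"
    have mem: "?u \<in> H1" "?v \<in> H1"
      using w x \<phi> solution_operator_mem(1) by (auto simp: weak_solutions_iff)
    \<comment> \<open>Conjugation puts \<open>?u\<close> in the first argument of the expansion of
      \<open>?l ?z\<close>, as in that of \<open>?l w\<close>. The terms \<open>h ?u ?v\<close> then
      cancel in the difference.\<close>
    have "?l ?z = cnj (?l ?z)"
      using mem(2) by (simp add: dn_form_diagonal[OF x \<phi>] complex_eq_iff form.Im_diagonal)
    also have "\<dots> = cnj (h ?v ?u - ?z * cinner ?v ?u)"
      using w by (subst dn_form_eq[OF x _ \<phi> \<phi>]) auto
    also have "\<dots> = h ?u ?v - ?z * cinner ?u ?v"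
      using form.hermitian[OF mem(2,1)] cinner_commute[of ?u ?v] by simp
    finally have "?l w - ?l ?z = - cinner ?u ?v * (w - ?z)"
      using dn_form_eq[OF _ x \<phi> \<phi>, of w] w by (simp add: algebra_simps)
    then show "- cinner ?u ?v = (?l w - ?l ?z) / (w - ?z)" using w by simp
  qed
  moreover have "((\<lambda>w. - cinner (S w \<phi>) (S ?z \<phi>)) \<longlongrightarrow> - cinner (S ?z \<phi>) (S ?z \<phi>)) (at ?z)"
  proof (intro tendsto_minus bounded_linear.tendsto[OF _ solution_operator_continuous[OF x \<phi>]])
    show "bounded_linear (\<lambda>u. cinner u (S ?z \<phi>))"
      by (rule bounded_linear_intro[of _ "norm (S ?z \<phi>)"])
        (simp_all add: cinner_add_left scaleR_eq_scaleC cinner_scaleC_left cmod_cinner_le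
          scaleC_complex_def)
  qed
  ultimately have "((\<lambda>w. (?l w - ?l ?z) / (w - ?z)) \<longlongrightarrow> - cinner (S ?z \<phi>) (S ?z \<phi>)) (at ?z)"
    by (rule Lim_transform_eventually[rotated])
  then show "(?l has_field_derivative - complex_of_real ((norm (S ?z \<phi>))\<^sup>2)) (at ?z)"
    by (simp add: has_field_derivative_iff cinner_self)
qed

section \<open>Reduction of all conditions to one lower bound\<close>

definition bounded_below :: "complex \<Rightarrow> bool"
  where "bounded_below z \<longleftrightarrow> (\<exists>c>0. \<forall>\<phi>\<in>\<Gamma> ` H1. c * norm \<phi> \<le> norm (S z \<phi>))"

lemma bounded_below_cong:
  assumes "z \<in> resolvent_set A" "w \<in> resolvent_set A"
  shows "bounded_below z \<longleftrightarrow> bounded_below w"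
proof -
  have "bounded_below w"
    if z: "z \<in> resolvent_set A" and w: "w \<in> resolvent_set A" and "bounded_below z" for z w
  proof -
    obtain c where c: "c > 0" "\<And>\<phi>. \<phi> \<in> \<Gamma> ` H1 \<Longrightarrow> c * norm \<phi> \<le> norm (S z \<phi>)"
      using \<open>bounded_below z\<close> by (auto simp: bounded_below_def)
    obtain C where C: "C > 0" "\<And>\<phi>. \<phi> \<in> \<Gamma> ` H1 \<Longrightarrow> norm (S z \<phi>) \<le> C * norm (S w \<phi>)"
      using norm_solution_operator_le[OF z w] by blast
    have "c / C * norm \<phi> \<le> norm (S w \<phi>)" if "\<phi> \<in> \<Gamma> ` H1" for \<phi>
      using order_trans[OF c(2)[OF that] C(2)[OF that]] C(1) by (simp add: field_simps)
    then show ?thesis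
      unfolding bounded_below_def using c(1) C(1) by (intro exI[of _ "c / C"]) simp
  qed
  then show ?thesis using assms by blast
qed

text \<open>Serves the three kinds of quadratic form at once, with \<open>r = 1\<close> for the
  solution form and the derivative and \<open>r = Im z\<close> for the imaginary part. Constants
  translate as \<open>c\<close> to \<open>sqrt (c / r)\<close> and back as \<open>c\<close> to
  \<open>r * c^2\<close>.\<close>

lemma uniformly_positive_iff_bounded_below:
  assumes r: "r > 0" and q: "\<And>\<phi>. \<phi> \<in> \<Gamma> ` H1 \<Longrightarrow> q \<phi> = complex_of_real (r * (norm (S z \<phi>))\<^sup>2)"
  shows "uniformly_positive_on (\<Gamma> ` H1) q \<longleftrightarrow> bounded_below z"
proof -
  have "q \<phi> - complex_of_real (c * (norm \<phi>)\<^sup>2) \<in> \<real>\<^sub>\<ge>\<^sub>0 \<longleftrightarrow> sqrt (c / r) * norm \<phi> \<le> norm (S z \<phi>)"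
    if "\<phi> \<in> \<Gamma> ` H1" "c > 0" for \<phi> c
  proof -
    have "q \<phi> - complex_of_real (c * (norm \<phi>)\<^sup>2) \<in> \<real>\<^sub>\<ge>\<^sub>0 \<longleftrightarrow> c * (norm \<phi>)\<^sup>2 \<le> r * (norm (S z \<phi>))\<^sup>2"
      unfolding q[OF that(1)] of_real_diff[symmetric] nonneg_Reals_of_real_iff by simp
    also have "\<dots> \<longleftrightarrow> (sqrt (c / r) * norm \<phi>)\<^sup>2 \<le> (norm (S z \<phi>))\<^sup>2"
      using r that(2) by (simp add: power_mult_distrib field_simps)
    also have "\<dots> \<longleftrightarrow> sqrt (c / r) * norm \<phi> \<le> norm (S z \<phi>)"
      using r that(2) by (intro power_mono_iff) auto
    finally show ?thesis .
  qed
  then have "uniformly_positive_on (\<Gamma> ` H1) q \<longleftrightarrow>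
      (\<exists>c>0. \<forall>\<phi>\<in>\<Gamma> ` H1. sqrt (c / r) * norm \<phi> \<le> norm (S z \<phi>))"
    unfolding uniformly_positive_on_def by blast
  also have "\<dots> \<longleftrightarrow> bounded_below z"
    unfolding bounded_below_def
  proof safe
    fix c :: real assume "c > 0" "\<forall>\<phi>\<in>\<Gamma> ` H1. sqrt (c / r) * norm \<phi> \<le> norm (S z \<phi>)"
    then show "\<exists>c>0. \<forall>\<phi>\<in>\<Gamma> ` H1. c * norm \<phi> \<le> norm (S z \<phi>)"
      using r by (intro exI[of _ "sqrt (c / r)"]) simp
  next
    fix c :: real assume "c > 0" "\<forall>\<phi>\<in>\<Gamma> ` H1. c * norm \<phi> \<le> norm (S z \<phi>)"
    then show "\<exists>c>0. \<forall>\<phi>\<in>\<Gamma> ` H1. sqrt (c / r) * norm \<phi> \<le> norm (S z \<phi>)"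
      using r by (intro exI[of _ "r * c\<^sup>2"]) simp
  qed
  finally show ?thesis .
qed

lemma solution_form_positive_iff:
  "uniformly_positive_on (\<Gamma> ` H1) (solution_form h H1 \<Gamma> z) \<longleftrightarrow> bounded_below z"
  by (rule uniformly_positive_iff_bounded_below[of 1]) (simp_all add: solution_form_def)

lemma minus_form_Im_positive_iff:
  assumes "Im z > 0"
  shows "uniformly_positive_on (\<Gamma> ` H1) (\<lambda>\<phi>. - form_Im (dn_form h H1 \<Gamma> z) \<phi> \<phi>) \<longleftrightarrow>
    bounded_below z"
  using assms nonreal_in_resolvent_set[of z]
  by (intro uniformly_positive_iff_bounded_below[of "Im z"]) (simp_all add: form_Im_dn_form)

lemma minus_dn_form_deriv_positive_iff:
  assumes "complex_of_real x \<in> resolvent_set A"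
  shows "uniformly_positive_on (\<Gamma> ` H1) (\<lambda>\<phi>. - dn_form_deriv h H1 \<Gamma> x \<phi> \<phi>) \<longleftrightarrow>
    bounded_below x"
  using assms
  by (intro uniformly_positive_iff_bounded_below[of 1]) (simp_all add: dn_form_deriv_real)

end

theorem theorem3p17:
  fixes h :: "'h::chilbert_space \<Rightarrow> 'h \<Rightarrow> complex"
    and H1 :: "'h set"
    and \<Gamma> :: "'h \<Rightarrow> 'g::chilbert_space"
  assumes "closed_nonneg_form h H1"
    and "boundary_pair h H1 \<Gamma>"
  shows "let
      \<sigma>D = spectrum (dirichlet_operator h H1 \<Gamma>);
      G12 = \<Gamma> ` H1;
      S = solution_operator h H1 \<Gamma>;
      q = solution_form h H1 \<Gamma>;
      l = dn_form h H1 \<Gamma>;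
      l' = dn_form_deriv h H1 \<Gamma>;
      i = positive_boundary_pair h H1 \<Gamma>;
      ii = (\<lambda>z. uniformly_positive_on G12 (q z));
      iii = (\<lambda>z. \<exists>c>0. \<forall>\<phi>\<in>G12. norm (S z \<phi>) \<ge> c * norm \<phi>);
      iv = (\<lambda>z. uniformly_positive_on G12 (\<lambda>\<phi>. - form_Im (l z) \<phi> \<phi>));
      v = (\<lambda>x::real. uniformly_positive_on G12 (\<lambda>\<phi>. - l' (complex_of_real x) \<phi> \<phi>))
    in
      (i \<longleftrightarrow> (\<exists>z. z \<notin> \<sigma>D \<and> ii z)) \<and>
      (i \<longleftrightarrow> (\<forall>z. z \<notin> \<sigma>D \<longrightarrow> ii z)) \<and>
      (i \<longleftrightarrow> (\<exists>z. z \<notin> \<sigma>D \<and> iii z)) \<and>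
      (i \<longleftrightarrow> (\<forall>z. z \<notin> \<sigma>D \<longrightarrow> iii z)) \<and>
      (i \<longleftrightarrow> (\<exists>z. Im z > 0 \<and> iv z)) \<and>
      (i \<longleftrightarrow> (\<forall>z. Im z > 0 \<longrightarrow> iv z)) \<and>
      (i \<longleftrightarrow> (\<exists>x. complex_of_real x \<notin> \<sigma>D \<and> v x)) \<and>
      (i \<longleftrightarrow> (\<forall>x. complex_of_real x \<notin> \<sigma>D \<longrightarrow> v x))"
proof -
  interpret form_with_boundary_pair h H1 \<Gamma>
    using assms by unfold_locales
  \<comment> \<open>\<open>P\<close> is the common truth value of \<open>bounded_below\<close> on
    the resolvent set; every condition rewrites to it.\<close>
  obtain P where P: "\<And>z. z \<in> resolvent_set A \<Longrightarrow> bounded_below z \<longleftrightarrow> P"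
    using bounded_below_cong by blast
  have i: "positive_boundary_pair h H1 \<Gamma> \<longleftrightarrow> P"
    by (simp add: positive_boundary_pair_def solution_form_positive_iff P
        minus_one_in_resolvent_set)
  have nonreal: "z \<in> resolvent_set A" if "Im z > 0" for z
    using nonreal_in_resolvent_set[of z] that by simp
  \<comment> \<open>The versions with "some" also require that the points over which they range
    exist: \<open>-1\<close> on the real line and \<open>\<i>\<close> in the upper
    half-plane.\<close>
  have real: "\<exists>x. complex_of_real x \<in> resolvent_set A"
    using minus_one_in_resolvent_set by (intro exI[of _ "-1"]) simp
  have upper: "\<exists>z. Im z > 0" by (intro exI[of _ \<i>]) simp
  show ?thesis
    unfolding Let_def i not_in_spectrum_iff solution_form_positive_iff
      bounded_below_def[symmetric]
    using minus_one_in_resolvent_set real upper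
    by (auto simp: P nonreal minus_form_Im_positive_iff minus_dn_form_deriv_positive_iff)
qed

end
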